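(* Conservative dual consistency (CDC) is strictly stronger than partial path consistency (PPC): every constraint network that is CDC-consistent is PPC-consistent, and there exists a constraint network that is PPC-consistent but not CDC-consistent.
   Context: A constraint network (CN) $P$ consists of a finite set $\mathrm{vars}(P)$ of variables and a finite set $\mathrm{cons}(P)$ of constraints. Each variable $x$ has a finite initial domain $\mathrm{dom}^{\mathrm{init}}(x)$ and a current domain $\mathrm{dom}(x)\subseteq \mathrm{dom}^{\mathrm{init}}(x)$. Each constraint $c$ has a scope $\mathrm{scp}(c)\subseteq\mathrm{vars}(P)$ (its arity is $|\mathrm{scp}(c)|$) and a relation $\mathrm{rel}(c)\subseteq\prod_{x\in \mathrm{scp}(c)}\mathrm{dom}^{\mathrm{init}}(x)$ of allowed tuples. All CNs are normalized (distinct constraints have distinct scopes), have no unary constraint, and no universal constraint (relation equal to the full product of initial domains). Constraints may have any arity $\ge 2$. A value of $P$ is a pair $(x,a)$ with $x\in\mathrm{vars}(P)$, $a\in\mathrm{dom}(x)$; we write $(x,a)\in P$. If some current domain of $P$ is empty we write $P=\bot$, and by convention $(x,a)\notin\bot$ for every pair $(x,a)$. An instantiation is a set $I=\{(x_1,a_1),\dots,(x_k,a_k)\}$ with distinct variables $x_i$ and $a_i\in\mathrm{dom}^{\mathrm{init}}(x_i)$. It is valid on $P$ if $a_i\in\mathrm{dom}(x_i)$ for all $i$. It is locally consistent on $P$ if it is valid and every constraint of $P$ whose scope is contained in $\{x_1,\dots,x_k\}$ is satisfied by $I$. When writing $\{(x,a),(y,b)\}$ it is assumed that $x\ne y$. A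 support for $(x,a)$ on a constraint $c$ with $x\in\mathrm{scp}(c)$ is a valid instantiation of $\mathrm{scp}(c)$ that satisfies $c$ and contains $(x,a)$. A value $(x,a)$ of $P$ is GAC-consistent if it has a support on every constraint involving $x$; $P$ is GAC-consistent if all its values are. $GAC(P)$ is the CN obtained from $P$ by repeatedly removing from current domains the values that are not GAC-consistent, until a fixed point is reached (the result does not depend on the order); if a domain becomes empty, $GAC(P)=\bot$. $P|_{x=a}$ is obtained from $P$ by removing every value $b\neq a$ from $\mathrm{dom}(x)$. CDC: $P$ is CDC-consistent iff for every locally consistent instantiation $\{(x,a),(y,b)\}$ on $P$ such that there is a constraint $c\in\mathrm{cons}(P)$ with $\mathrm{scp}(c)=\{x,y\}$, one has $(y,b)\in GAC(P|_{x=a})$ and $(x,a)\in GAC(P|_{y=b})$. PPC: a path of $P$ is a sequence $\langle x_1,\dots,x_k\rangle$ of variables of $P$ (repetitions allowed) with $x_1\neq x_k$, $k\ge 2$. It is a graph-path if for every $i\in\{1,\dots,k-1\}$ some constraint of $P$ has scope $\{x_i,x_{i+1}\}$ (a binary constraint). It is closed if moreover some constraint of $P$ has scope $\{x_1,x_k\}$. An instantiation $\{(x_1,a_1),(x_k,a_k)\}$ is consistent on the path $\langle x_1,\dots,x_k\rangle$ iff there is a tuple $(b_1,\dots,b_k)\in\prod_{i=1}^k\mathrm{dom}(x_i)$ with $b_1=a_1$, $b_k=a_k$ and, for each $i\in\{1,\dots,k-1\}$, $\{(x_i,b_i),(x_{i+1},b_{i+1})\}$ is a locally consistent instantiation on $P$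 (so $b_i=b_{i+1}$ if $x_i=x_{i+1}$; otherwise different occurrences of the same variable in the path may take different values). A path $\langle x_1,\dots,x_k\rangle$ is consistent iff every locally consistent instantiation of $\{x_1,x_k\}$ on $P$ is consistent on it. $P$ is PPC-consistent iff every closed graph-path of $P$ is consistent. *)

theory Defs
  imports "HOL-Library.FuncSet"
begin

text \<open>
  A tuple over a scope \<open>S\<close> is an extensional function on \<open>S\<close>, so that a relation of a
  constraint is literally a subset of the product \<open>\<Pi>\<^sub>E x\<in>S. dom_init x\<close>.
\<close>

record ('v, 'a) constraint =
  scp :: "'v set"
  rel :: "('v \<Rightarrow> 'a) set"

record ('v, 'a) network =
  vars :: "'v set"
  cons :: "('v, 'a) constraint set"
  dom_init :: "'v \<Rightarrow> 'a set"
  dom_cur :: "'v \<Rightarrow> 'a set"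

definition constraint_network :: "('v, 'a) network \<Rightarrow> bool" where
  "constraint_network P \<longleftrightarrow>
     finite (vars P) \<and> finite (cons P) \<and>
     (\<forall>x\<in>vars P. finite (dom_init P x) \<and> dom_cur P x \<subseteq> dom_init P x) \<and>
     (\<forall>c\<in>cons P. scp c \<subseteq> vars P \<and> card (scp c) \<ge> 2 \<and>
        rel c \<subseteq> PiE (scp c) (dom_init P) \<and> rel c \<noteq> PiE (scp c) (dom_init P)) \<and>
     inj_on scp (cons P)"

text \<open>
  \<open>P = \<bottom>\<close> is a property of the current domains rather than a separate object; the convention
  that \<open>\<bottom>\<close> has no values is built into membership of a value in a network.
\<close>

definition is_bot :: "('v, 'a) network \<Rightarrow> bool" where
  "is_bot P \<longleftrightarrow> (\<exists>x\<in>vars P. dom_cur P x = {})"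

definition value_in :: "'v \<times> 'a \<Rightarrow> ('v, 'a) network \<Rightarrow> bool" where
  "value_in v P \<longleftrightarrow> \<not> is_bot P \<and> fst v \<in> vars P \<and> snd v \<in> dom_cur P (fst v)"

definition instantiation_of :: "('v, 'a) network \<Rightarrow> ('v \<times> 'a) set \<Rightarrow> bool" where
  "instantiation_of P I \<longleftrightarrow>
     finite I \<and> single_valued I \<and> (\<forall>(x, a)\<in>I. x \<in> vars P \<and> a \<in> dom_init P x)"

definition valid_inst :: "('v, 'a) network \<Rightarrow> ('v \<times> 'a) set \<Rightarrow> bool" where
  "valid_inst P I \<longleftrightarrow> instantiation_of P I \<and> (\<forall>(x, a)\<in>I. a \<in> dom_cur P x)"

definition satisfies :: "('v \<times> 'a) set \<Rightarrow> ('v, 'a) constraint \<Rightarrow> bool" where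
  "satisfies I c \<longleftrightarrow> (\<exists>t\<in>rel c. \<forall>x\<in>scp c. (x, t x) \<in> I)"

definition locally_consistent :: "('v, 'a) network \<Rightarrow> ('v \<times> 'a) set \<Rightarrow> bool" where
  "locally_consistent P I \<longleftrightarrow>
     valid_inst P I \<and> (\<forall>c\<in>cons P. scp c \<subseteq> Domain I \<longrightarrow> satisfies I c)"

definition support ::
    "('v, 'a) network \<Rightarrow> ('v, 'a) constraint \<Rightarrow> 'v \<times> 'a \<Rightarrow> ('v \<times> 'a) set \<Rightarrow> bool" where
  "support P c v I \<longleftrightarrow> valid_inst P I \<and> Domain I = scp c \<and> satisfies I c \<and> v \<in> I"

definition gac_value :: "('v, 'a) network \<Rightarrow> 'v \<times> 'a \<Rightarrow> bool" where
  "gac_value P v \<longleftrightarrow> (\<forall>c\<in>cons P. fst v \<in> scp c \<longrightarrow> (\<exists>I. support P c v I))"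

text \<open>
  \<open>GAC P\<close> is the normal form of \<open>P\<close> under removal of single values that are not
  GAC-consistent.  Removal may go on after a domain has become empty; the result then still
  has an empty domain, i.e. it is \<open>\<bottom>\<close>, and \<open>value_in\<close> is false for it.
  Existence and uniqueness of the normal form are proved in \<open>GAC_ex1\<close>.
\<close>

inductive gac_step :: "('v, 'a) network \<Rightarrow> ('v, 'a) network \<Rightarrow> bool" for P where
  "x \<in> vars P \<Longrightarrow> a \<in> dom_cur P x \<Longrightarrow> \<not> gac_value P (x, a) \<Longrightarrow>
     gac_step P (P\<lparr>dom_cur := (dom_cur P)(x := dom_cur P x - {a})\<rparr>)"

definition GAC :: "('v, 'a) network \<Rightarrow> ('v, 'a) network" where
  "GAC P = (THE Q. gac_step\<^sup>*\<^sup>* P Q \<and> \<not> (\<exists>R. gac_step Q R))"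

definition assign :: "('v, 'a) network \<Rightarrow> 'v \<Rightarrow> 'a \<Rightarrow> ('v, 'a) network" where
  "assign P x a = P\<lparr>dom_cur := (dom_cur P)(x := dom_cur P x \<inter> {a})\<rparr>"

definition CDC_consistent :: "('v, 'a) network \<Rightarrow> bool" where
  "CDC_consistent P \<longleftrightarrow>
     (\<forall>x a y b. x \<noteq> y \<and> locally_consistent P {(x, a), (y, b)} \<and> (\<exists>c\<in>cons P. scp c = {x, y})
        \<longrightarrow> value_in (y, b) (GAC (assign P x a)) \<and> value_in (x, a) (GAC (assign P y b)))"

definition is_path :: "('v, 'a) network \<Rightarrow> 'v list \<Rightarrow> bool" where
  "is_path P xs \<longleftrightarrow> length xs \<ge> 2 \<and> set xs \<subseteq> vars P \<and> hd xs \<noteq> last xs"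

definition graph_path :: "('v, 'a) network \<Rightarrow> 'v list \<Rightarrow> bool" where
  "graph_path P xs \<longleftrightarrow> is_path P xs \<and>
     (\<forall>i. Suc i < length xs \<longrightarrow> (\<exists>c\<in>cons P. scp c = {xs ! i, xs ! Suc i}))"

definition closed_graph_path :: "('v, 'a) network \<Rightarrow> 'v list \<Rightarrow> bool" where
  "closed_graph_path P xs \<longleftrightarrow> graph_path P xs \<and> (\<exists>c\<in>cons P. scp c = {hd xs, last xs})"

text \<open>
  For \<open>xs ! i = xs ! Suc i\<close> the set of two pairs below is an instantiation only if
  \<open>bs ! i = bs ! Suc i\<close>, by single-valuedness.
\<close>

definition consistent_on_path :: "('v, 'a) network \<Rightarrow> 'v list \<Rightarrow> 'a \<Rightarrow> 'a \<Rightarrow> bool" where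
  "consistent_on_path P xs a b \<longleftrightarrow>
     (\<exists>bs. length bs = length xs \<and> (\<forall>i<length xs. bs ! i \<in> dom_cur P (xs ! i)) \<and>
        hd bs = a \<and> last bs = b \<and>
        (\<forall>i. Suc i < length xs \<longrightarrow>
           locally_consistent P {(xs ! i, bs ! i), (xs ! Suc i, bs ! Suc i)}))"

definition path_consistent :: "('v, 'a) network \<Rightarrow> 'v list \<Rightarrow> bool" where
  "path_consistent P xs \<longleftrightarrow>
     (\<forall>a b. locally_consistent P {(hd xs, a), (last xs, b)} \<longrightarrow> consistent_on_path P xs a b)"

definition PPC_consistent :: "('v, 'a) network \<Rightarrow> bool" where
  "PPC_consistent P \<longleftrightarrow> (\<forall>xs. closed_graph_path P xs \<longrightarrow> path_consistent P xs)"

definition subnet :: "('v, 'a) network \<Rightarrow> ('v, 'a) network \<Rightarrow> bool" where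
  "subnet Q P \<longleftrightarrow> vars Q = vars P \<and> cons Q = cons P \<and> dom_init Q = dom_init P \<and>
     (\<forall>x. dom_cur Q x \<subseteq> dom_cur P x)"

lemma subnet_refl: "subnet P P"
  by (simp add: subnet_def)

lemma subnet_trans:
  assumes "subnet R Q" "subnet Q P"
  shows "subnet R P"
  using assms unfolding subnet_def by (metis order_trans)

lemma subnet_antisym:
  assumes "subnet P Q" "subnet Q P"
  shows "P = Q"
proof -
  have "dom_cur P = dom_cur Q"
    using assms by (intro ext subset_antisym) (simp_all add: subnet_def)
  then show ?thesis
    using assms(1) by (simp add: subnet_def)
qed

lemma gac_step_subnet: "gac_step P Q \<Longrightarrow> subnet Q P"
  by (auto simp: subnet_def elim!: gac_step.cases split: if_splits)

lemma gac_steps_subnet: "gac_step\<^sup>*\<^sup>* P Q \<Longrightarrow> subnet Q P"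
proof (induction rule: rtranclp_induct)
  case base
  show ?case by (rule subnet_refl)
next
  case (step Q R)
  show ?case by (rule subnet_trans[OF gac_step_subnet[OF step(2)] step(3)])
qed

lemma valid_inst_subnet: "subnet Q P \<Longrightarrow> valid_inst Q I \<Longrightarrow> valid_inst P I"
  unfolding subnet_def valid_inst_def instantiation_of_def by fastforce

lemma gac_value_subnet:
  assumes "subnet Q P" "gac_value Q v"
  shows "gac_value P v"
  unfolding gac_value_def
proof (intro ballI impI)
  fix c assume "c \<in> cons P" "fst v \<in> scp c"
  then have "\<exists>I. support Q c v I"
    using assms unfolding subnet_def gac_value_def by simp
  then show "\<exists>I. support P c v I"
    using valid_inst_subnet[OF assms(1)] unfolding support_def by auto
qed

lemma gac_normal_form_greatest:
  assumes "gac_step\<^sup>*\<^sup>* P Q" "subnet R P" "\<not> (\<exists>S. gac_step R S)"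
  shows "subnet R Q"
  using assms(1)
proof (induction rule: rtranclp_induct)
  case base
  then show ?case by (fact assms(2))
next
  case (step Q Q')
  from step(2) obtain x a where xa: "x \<in> vars Q" "a \<in> dom_cur Q x" "\<not> gac_value Q (x, a)"
    and Q': "Q' = Q\<lparr>dom_cur := (dom_cur Q)(x := dom_cur Q x - {a})\<rparr>"
    by (auto elim!: gac_step.cases)
  have "a \<notin> dom_cur R x"
  proof
    assume "a \<in> dom_cur R x"
    moreover have "\<not> gac_value R (x, a)"
      using gac_value_subnet[OF step(3)] xa by blast
    ultimately show False
      using assms(3) gac_step.intros[of x R a] xa(1) step(3) by (auto simp: subnet_def)
  qed
  with step(3) show ?case
    by (auto simp: Q' subnet_def)
qed

lemma gac_normal_form_exists:
  assumes "finite (vars P)" "\<forall>x\<in>vars P. finite (dom_cur P x)"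
  shows "\<exists>Q. gac_step\<^sup>*\<^sup>* P Q \<and> \<not> (\<exists>R. gac_step Q R)"
  using assms
proof (induction "\<Sum>x\<in>vars P. card (dom_cur P x)" arbitrary: P rule: less_induct)
  case less
  show ?case
  proof (cases "\<exists>R. gac_step P R")
    case True
    then obtain x a where xa: "x \<in> vars P" "a \<in> dom_cur P x" "\<not> gac_value P (x, a)"
      by (auto elim!: gac_step.cases)
    define R where "R = P\<lparr>dom_cur := (dom_cur P)(x := dom_cur P x - {a})\<rparr>"
    have step: "gac_step P R"
      unfolding R_def using xa by (rule gac_step.intros)
    have "(\<Sum>y\<in>vars P. card (dom_cur R y)) < (\<Sum>y\<in>vars P. card (dom_cur P y))"
    proof (rule sum_strict_mono_ex1)
      show "\<forall>y\<in>vars P. card (dom_cur R y) \<le> card (dom_cur P y)"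
        using less.prems by (auto simp: R_def intro!: card_mono)
      show "\<exists>y\<in>vars P. card (dom_cur R y) < card (dom_cur P y)"
        using less.prems xa by (intro bexI[of _ x]) (simp_all add: R_def card_Diff1_less del: card_Diff_insert card_Diff_singleton)
    qed (fact less.prems)
    moreover have "vars R = vars P" "\<forall>y\<in>vars R. finite (dom_cur R y)"
      using less.prems by (auto simp: R_def)
    ultimately obtain Q where "gac_step\<^sup>*\<^sup>* R Q" "\<not> (\<exists>S. gac_step Q S)"
      using less.hyps[of R] less.prems by auto
    with step show ?thesis
      by (meson converse_rtranclp_into_rtranclp)
  qed blast
qed

lemma GAC_ex1:
  assumes "constraint_network P"
  shows "\<exists>!Q. gac_step\<^sup>*\<^sup>* P Q \<and> \<not> (\<exists>R. gac_step Q R)"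
proof -
  have "finite (vars P)" "\<forall>x\<in>vars P. finite (dom_cur P x)"
    using assms by (auto simp: constraint_network_def intro: finite_subset)
  from gac_normal_form_exists[OF this] show ?thesis
  proof (rule ex_ex1I)
    fix Q R
    assume Q: "gac_step\<^sup>*\<^sup>* P Q \<and> \<not> (\<exists>S. gac_step Q S)"
      and R: "gac_step\<^sup>*\<^sup>* P R \<and> \<not> (\<exists>S. gac_step R S)"
    show "Q = R"
    proof (rule subnet_antisym)
      show "subnet Q R"
        using Q R by (blast intro: gac_normal_form_greatest gac_steps_subnet)
      show "subnet R Q"
        using Q R by (blast intro: gac_normal_form_greatest gac_steps_subnet)
    qed
  qed
qed

lemma constraint_network_assign: "constraint_network P \<Longrightarrow> constraint_network (assign P x a)"
  unfolding constraint_network_def assign_def by (simp add: le_infI1)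

end

theory Submission
  imports Defs
begin

text \<open>
  Let \<open>b\<close> survive at the last variable of a graph path in \<open>GAC P|\<^bsub>x=a\<^esub>\<close>, where \<open>x\<close> is the
  first variable.  Following binary supports backwards along the path stays within the current
  domains of \<open>GAC P|\<^bsub>x=a\<^esub>\<close>, hence ends at \<open>a\<close>, the only value that \<open>x\<close> can have there.
  Strictness holds since PPC ignores non-binary constraints, whereas GAC does not: it suffices
  to add an unsatisfiable ternary constraint to a single binary constraint.
\<close>

lemma GAC_normal_form:
  assumes "constraint_network P"
  shows "gac_step\<^sup>*\<^sup>* P (GAC P)" and "\<not> gac_step (GAC P) R"
  using theI'[OF GAC_ex1[OF assms]] unfolding GAC_def by blast+

lemma subnet_GAC:
  assumes "constraint_network P"
  shows "subnet (GAC P) P"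
  using GAC_normal_form(1)[OF assms] by (rule gac_steps_subnet)

text \<open>A current value without the required supports would allow one more
  \<open>gac_step\<close>, contradicting normality.\<close>

lemma gac_value_GAC:
  assumes "constraint_network P" "x \<in> vars P" "a \<in> dom_cur (GAC P) x"
  shows "gac_value (GAC P) (x, a)"
  using assms GAC_normal_form(2) gac_step.intros[of x "GAC P" a] subnet_GAC[OF assms(1)]
  unfolding subnet_def by metis

lemma subnet_assign: "subnet (assign P x a) P"
  by (simp add: subnet_def assign_def)

lemma constraint_network_subnet:
  assumes "constraint_network P" "subnet Q P"
  shows "constraint_network Q"
  using assms unfolding constraint_network_def subnet_def by simp (meson order_trans)

lemma locally_consistent_subnet:
  assumes "subnet Q P" "locally_consistent Q I"
  shows "locally_consistent P I"
  using assms valid_inst_subnet[OF assms(1)] by (simp add: locally_consistent_def subnet_def)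

text \<open>Scopes have at least two elements, so one contained in a pair is the whole pair, and
  normalization then identifies the constraints.\<close>

lemma binary_constraint_unique:
  assumes "constraint_network P" "c \<in> cons P" "d \<in> cons P" "scp c = {x, y}" "scp d \<subseteq> {x, y}"
  shows "x \<noteq> y" and "d = c"
proof -
  have card: "2 \<le> card (scp c)" "2 \<le> card (scp d)" and inj: "inj_on scp (cons P)"
    using assms by (auto simp: constraint_network_def)
  show "x \<noteq> y"
    using card(1) assms(4) by auto
  have "card {x, y} \<le> 2"
    by (simp add: card_insert_if)
  with card have "scp d = {x, y}"
    using assms(5) by (intro card_seteq) auto
  then show "d = c"
    using inj assms by (auto dest: inj_onD)
qed

text \<open>A support on a binary constraint is already locally consistent, because no other
  constraint has its scope inside the pair.\<close>

lemma gac_value_extend: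
  assumes "constraint_network P" "gac_value P (y, b)" "c \<in> cons P" "scp c = {x, y}"
  obtains a where "a \<in> dom_cur P x" "locally_consistent P {(x, a), (y, b)}"
proof -
  from assms obtain I where I: "valid_inst P I" "Domain I = {x, y}" "satisfies I c" "(y, b) \<in> I"
    unfolding gac_value_def support_def by fastforce
  then obtain a where a: "(x, a) \<in> I"
    by blast
  have "single_valued I"
    using I(1) by (simp add: valid_inst_def instantiation_of_def)
  \<comment> \<open>Single-valuedness leaves exactly one pair for each of the two variables.\<close>
  with I a have "I = {(x, a), (y, b)}"
    by (auto dest: single_valuedD)
  moreover have "locally_consistent P I"
    unfolding locally_consistent_def using I binary_constraint_unique(2)[OF assms(1,3) _ assms(4)]
    by auto
  moreover have "a \<in> dom_cur P x"
    using I(1) a by (auto simp: valid_inst_def)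
  ultimately show thesis
    using that by blast
qed

text \<open>Only the last value is prescribed: the values are chosen from the end of the path
  towards its head, one binary support at a time. Repeated variables cause no conflict, since each
  position is chosen separately.\<close>

lemma gac_values_along_path:
  assumes "constraint_network P"
    and "\<And>x a. x \<in> vars P \<Longrightarrow> a \<in> dom_cur P x \<Longrightarrow> gac_value P (x, a)"
    and "xs \<noteq> []" "set xs \<subseteq> vars P"
    and "\<And>i. Suc i < length xs \<Longrightarrow> \<exists>c\<in>cons P. scp c = {xs ! i, xs ! Suc i}"
    and "b \<in> dom_cur P (last xs)"
  shows "\<exists>bs. length bs = length xs \<and> (\<forall>i<length xs. bs ! i \<in> dom_cur P (xs ! i)) \<and>
           last bs = b \<and>
           (\<forall>i. Suc i < length xs \<longrightarrow>
              locally_consistent P {(xs ! i, bs ! i), (xs ! Suc i, bs ! Suc i)})"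
  using assms(3-)
proof (induction xs rule: list_nonempty_induct)
  case (single x)
  then show ?case
    by (intro exI[of _ "[b]"]) simp
next
  case (cons x xs)
  have "\<exists>c\<in>cons P. scp c = {xs ! i, xs ! Suc i}" if "Suc i < length xs" for i
    using cons.prems(2)[of "Suc i"] that by simp
  then obtain bs where bs: "length bs = length xs" "\<forall>i<length xs. bs ! i \<in> dom_cur P (xs ! i)"
      "last bs = b"
      "\<forall>i. Suc i < length xs \<longrightarrow>
         locally_consistent P {(xs ! i, bs ! i), (xs ! Suc i, bs ! Suc i)}"
    using cons by auto
  \<comment> \<open>The edge joining the new head to the tail; a support of \<open>bs ! 0\<close> on
    it supplies the value at \<open>x\<close>.\<close>
  obtain c where c: "c \<in> cons P" "scp c = {x, xs ! 0}"
    using cons.prems(2)[of 0] cons.hyps by auto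
  have "gac_value P (xs ! 0, bs ! 0)"
    using assms(2) bs(2) cons.hyps cons.prems(1) by (simp add: subset_iff)
  then obtain a where a: "a \<in> dom_cur P x" "locally_consistent P {(x, a), (xs ! 0, bs ! 0)}"
    using gac_value_extend[OF assms(1) _ c] by blast
  show ?case
  proof (intro exI[of _ "a # bs"] conjI allI impI)
    show "last (a # bs) = b"
      using bs(1,3) cons.hyps by auto
  next
    fix i assume "i < length (x # xs)"
    then show "(a # bs) ! i \<in> dom_cur P ((x # xs) ! i)"
      using a bs(2) by (cases i) auto
  next
    fix i assume "Suc i < length (x # xs)"
    then show "locally_consistent P
      {((x # xs) ! i, (a # bs) ! i), ((x # xs) ! Suc i, (a # bs) ! Suc i)}"
      using a bs(4) by (cases i) auto
  qed (use bs in simp)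
qed

lemma CDC_imp_PPC:
  assumes "constraint_network P" "CDC_consistent P"
  shows "PPC_consistent P"
  unfolding PPC_consistent_def path_consistent_def
proof (intro allI impI)
  fix xs a b
  assume closed: "closed_graph_path P xs"
    and lc: "locally_consistent P {(hd xs, a), (last xs, b)}"
  define Q where "Q = GAC (assign P (hd xs) a)"
  have assign: "constraint_network (assign P (hd xs) a)"
    using assms(1) by (rule constraint_network_assign)
  have sub: "subnet Q (assign P (hd xs) a)"
    unfolding Q_def by (rule subnet_GAC[OF assign])
  then have subP: "subnet Q P"
    using subnet_assign by (rule subnet_trans)
  have path: "xs \<noteq> []" "set xs \<subseteq> vars P" "hd xs \<noteq> last xs"
    "\<And>i. Suc i < length xs \<Longrightarrow> \<exists>c\<in>cons P. scp c = {xs ! i, xs ! Suc i}"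
    "\<exists>c\<in>cons P. scp c = {hd xs, last xs}"
    using closed by (auto simp: closed_graph_path_def graph_path_def is_path_def)
  \<comment> \<open>Closedness of the path provides the binary constraint between its ends that CDC
    asks for.\<close>
  have "b \<in> dom_cur Q (last xs)"
    using assms(2) lc path(3,5) unfolding CDC_consistent_def value_in_def Q_def by fastforce
  moreover have "gac_value Q (x, v)" if "x \<in> vars Q" "v \<in> dom_cur Q x" for x v
    using gac_value_GAC[OF assign] that subnet_GAC[OF assign] by (simp add: Q_def subnet_def)
  moreover have "vars Q = vars P" "cons Q = cons P"
    using subP by (simp_all add: subnet_def)
  ultimately obtain bs where bs: "length bs = length xs"
      "\<forall>i<length xs. bs ! i \<in> dom_cur Q (xs ! i)" "last bs = b"
      "\<forall>i. Suc i < length xs \<longrightarrow>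
         locally_consistent Q {(xs ! i, bs ! i), (xs ! Suc i, bs ! Suc i)}"
    using gac_values_along_path[OF constraint_network_subnet[OF assms(1) subP], of xs b] path
    by auto
  \<comment> \<open>The construction left the first value free; the assignment at
    \<open>hd xs\<close> now forces it to be \<open>a\<close>.\<close>
  have "hd bs \<in> dom_cur Q (hd xs)"
    using bs(1,2) path(1) by (metis hd_conv_nth length_0_conv length_greater_0_conv)
  also have "\<dots> \<subseteq> dom_cur (assign P (hd xs) a) (hd xs)"
    using sub by (simp add: subnet_def)
  also have "\<dots> \<subseteq> {a}"
    by (simp add: assign_def)
  finally have "hd bs = a"
    by simp
  moreover have "\<forall>i<length xs. bs ! i \<in> dom_cur P (xs ! i)"
    using bs(2) subP unfolding subnet_def by blast
  ultimately show "consistent_on_path P xs a b"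
    unfolding consistent_on_path_def using bs locally_consistent_subnet[OF subP] by blast
qed

text \<open>The restricted lambda makes the zero tuple extensional, as membership in
  \<open>PiE\<close> requires.\<close>

definition binary_zero :: "(nat, nat) constraint" where
  "binary_zero = \<lparr>scp = {0, 1}, rel = {\<lambda>x\<in>{0, 1}. 0}\<rparr>"

definition ternary_false :: "(nat, nat) constraint" where
  "ternary_false = \<lparr>scp = {0, 1, 2}, rel = {}\<rparr>"

definition separating_network :: "(nat, nat) network" where
  "separating_network =
     \<lparr>vars = {0, 1, 2}, cons = {binary_zero, ternary_false},
      dom_init = (\<lambda>_. {0, 1}), dom_cur = (\<lambda>_. {0, 1})\<rparr>"

lemma separating_network_constraint_network: "constraint_network separating_network"
proof -
  \<comment> \<open>The all-one tuple witnesses that \<open>binary_zero\<close> is not universal;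
    this is where a second domain value is needed.\<close>
  have "(\<lambda>x\<in>{0, 1}. 1) \<in> PiE {0, 1 :: nat} (\<lambda>_. {0, 1 :: nat})"
    by auto
  moreover have "(\<lambda>x\<in>{0, 1 :: nat}. 1 :: nat) \<noteq> (\<lambda>x\<in>{0, 1}. 0)"
    by (auto dest: fun_cong[of _ _ 0])
  ultimately have "{\<lambda>x\<in>{0, 1}. 0} \<noteq> PiE {0, 1 :: nat} (\<lambda>_. {0, 1 :: nat})"
    by blast
  moreover have "{} \<noteq> PiE {0, 1, 2 :: nat} (\<lambda>_. {0, 1 :: nat})"
    by (metis PiE_eq_empty_iff insert_not_empty)
  moreover have "card {0, 1 :: nat} \<noteq> card {0, 1, 2 :: nat}"
    by simp
  then have "{0, 1 :: nat} \<noteq> {0, 1, 2}"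
    by metis
  ultimately show ?thesis
    unfolding constraint_network_def separating_network_def binary_zero_def ternary_false_def
    by simp
qed

text \<open>A pair is too small to be the ternary scope, so graph-paths can only alternate between
  \<open>0\<close> and \<open>1\<close>.\<close>

lemma separating_network_binary_scope:
  assumes "c \<in> cons separating_network" "scp c = {x, y}"
  shows "{x, y} = {0, 1}"
proof -
  have "card {x, y} \<noteq> card {0, 1, 2 :: nat}"
    by (simp add: card_insert_if)
  then have "{x, y} \<noteq> {0, 1, 2}"
    by metis
  moreover have "scp c = {0, 1} \<or> scp c = {0, 1, 2}"
    using assms(1) unfolding separating_network_def binary_zero_def ternary_false_def by force
  ultimately show ?thesis
    using assms(2) by simp
qed

text \<open>Two variables do not cover the ternary scope, so \<open>binary_zero\<close> alone
  decides. The unordered hypothesis handles both orientations of an edge.\<close>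

lemma separating_network_locally_consistent_iff:
  assumes "{x, y} = {0, 1}"
  shows "locally_consistent separating_network {(x, a), (y, b)} \<longleftrightarrow> a = 0 \<and> b = 0"
proof -
  have "\<not> {0, 1, 2 :: nat} \<subseteq> {0, 1}"
    by auto
  then show ?thesis
    using assms
    by (auto simp: locally_consistent_def valid_inst_def instantiation_of_def satisfies_def
        separating_network_def binary_zero_def ternary_false_def single_valued_def doubleton_eq_iff)
qed

lemma separating_network_PPC: "PPC_consistent separating_network"
  unfolding PPC_consistent_def path_consistent_def
proof (intro allI impI)
  fix xs a b
  assume closed: "closed_graph_path separating_network xs"
    and lc: "locally_consistent separating_network {(hd xs, a), (last xs, b)}"
  then have ab: "a = 0" "b = 0"
    using separating_network_binary_scope separating_network_locally_consistent_iff
    by (auto simp: closed_graph_path_def)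
  have step: "locally_consistent separating_network {(xs ! i, 0), (xs ! Suc i, 0)}"
    if "Suc i < length xs" for i
    using closed that separating_network_binary_scope separating_network_locally_consistent_iff
    unfolding closed_graph_path_def graph_path_def by metis
  have "xs \<noteq> []"
    using closed by (auto simp: closed_graph_path_def graph_path_def is_path_def)
  with step ab show "consistent_on_path separating_network xs a b"
    unfolding consistent_on_path_def
    \<comment> \<open>The constant zero tuple satisfies every edge, and both end values are already
      known to be \<open>0\<close>.\<close>
    by (intro exI[of _ "replicate (length xs) 0"]) (simp add: separating_network_def)
qed

lemma separating_network_not_CDC: "\<not> CDC_consistent separating_network"
proof
  assume CDC: "CDC_consistent separating_network"
  define R where "R = assign separating_network 0 0"
  have R: "constraint_network R"
    unfolding R_def by (intro constraint_network_assign separating_network_constraint_network)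
  have "locally_consistent separating_network {(0, 0), (1, 0)}"
    by (simp add: separating_network_locally_consistent_iff)
  moreover have "\<exists>c\<in>cons separating_network. scp c = {0, 1}"
    by (simp add: separating_network_def binary_zero_def)
  ultimately have "value_in (1, 0) (GAC R)"
    using CDC zero_neq_one unfolding CDC_consistent_def R_def by blast
  \<comment> \<open>A value surviving at variable \<open>1\<close> would need a support on
    \<open>ternary_false\<close>, whose relation is empty.\<close>
  then have "gac_value (GAC R) (1, 0)"
    using gac_value_GAC[OF R] subnet_GAC[OF R] by (simp add: value_in_def subnet_def)
  moreover have "ternary_false \<in> cons (GAC R)"
    using subnet_GAC[OF R] by (simp add: subnet_def R_def assign_def separating_network_def)
  ultimately show False
    by (auto simp: gac_value_def support_def satisfies_def ternary_false_def)
qed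

theorem proposition13:
  shows "(\<forall>P :: ('v, 'a) network. constraint_network P \<and> CDC_consistent P \<longrightarrow> PPC_consistent P) \<and>
         (\<exists>P :: (nat, nat) network. constraint_network P \<and> PPC_consistent P \<and> \<not> CDC_consistent P)"
  using CDC_imp_PPC separating_network_constraint_network separating_network_PPC
    separating_network_not_CDC by blast

end
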